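(* Let $R$ be a commutative ring with identity, $S$ a multiplicatively closed subset of $R$, $M$ a finitely generated faithful multiplication $R$-module, and $N$ a weakly $S$-primary submodule of $M$. (1) If $\{0_R\}$ is an $S$-primary ideal of $R$, then $M\text{-}rad(N)$ is an $S$-prime submodule of $M$. (2) If $N$ is not $S$-primary, then $N^2=0_M$ and $M\text{-}rad(N)=M\text{-}rad(0_M)$. Moreover, if $R$ is a reduced ring, then nonzero weakly $S$-primary submodules of $M$ and nonzero $S$-primary submodules of $M$ coincide.
   Context: All modules are unital. A multiplicatively closed subset of $R$ is a non-empty subset closed under multiplication. $(N:_R M)=\{r\in R: rM\subseteq N\}$. $M$ is faithful if $(0:_R M)=0$. $M$ is a multiplication module if every submodule of $M$ has the form $IM$ for some ideal $I$ of $R$. For submodules $K=IM$, $L=JM$ of a multiplication module ($I,J$ ideals of $R$), $KL=IJM$, and $N^2=NN$. $M\text{-}rad(N)$ is the intersection of all prime submodules of $M$ containing $N$, where a proper submodule $P$ is prime if $rm\in P$ ($r\in R$, $m\in M$) implies $r\in(P:_R M)$ or $m\in P$. For a submodule $N$ of $M$ with $(N:_R M)\cap S=\emptyset$: $N$ is $S$-prime (resp. $S$-primary) if there is a fixed $s\in S$ such that for all $a\in R$, $m\in M$, $am\in N$ implies $sa\in(N:_R M)$ (resp. $sa\in\sqrt{(N:_R M)}$) or $sm\in N$; $N$ is weakly $S$-primary if there is a fixed $s\in S$ such that for all $a\in R$, $m\in M$, $0\neq am\in N$ implies $sa\in\sqrt{(N:_R M)}$ or $sm\in N$. An ideal of $R$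 is $S$-primary if it is an $S$-primary submodule of the $R$-module $R$. *)

theory Defs
  imports "HOL-Algebra.Module" "HOL-Algebra.Ideal_Product"
begin

text \<open>Not required to contain the identity, hence weaker than \<open>submonoid\<close>.\<close>

definition mult_closed_subset :: "('a, 'r) ring_scheme \<Rightarrow> 'a set \<Rightarrow> bool" where
  "mult_closed_subset R S \<longleftrightarrow>
     S \<subseteq> carrier R \<and> S \<noteq> {} \<and> (\<forall>a\<in>S. \<forall>b\<in>S. a \<otimes>\<^bsub>R\<^esub> b \<in> S)"

definition reduced_ring :: "('a, 'r) ring_scheme \<Rightarrow> bool" where
  "reduced_ring R \<longleftrightarrow>
     (\<forall>x\<in>carrier R. \<forall>n::nat. x [^]\<^bsub>R\<^esub> n = \<zero>\<^bsub>R\<^esub> \<longrightarrow> x = \<zero>\<^bsub>R\<^esub>)"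

definition ideal_radical :: "('a, 'r) ring_scheme \<Rightarrow> 'a set \<Rightarrow> 'a set" where
  "ideal_radical R I = {r \<in> carrier R. \<exists>n::nat. n > 0 \<and> r [^]\<^bsub>R\<^esub> n \<in> I}"

definition regular_module :: "('a, 'r) ring_scheme \<Rightarrow> ('a, 'a) module" where
  "regular_module R =
     \<lparr>carrier = carrier R, mult = mult R, one = one R, zero = zero R, add = add R, smult = mult R\<rparr>"

definition colon :: "('a, 'r) ring_scheme \<Rightarrow> ('a, 'b, 'm) module_scheme \<Rightarrow> 'b set \<Rightarrow> 'a set" where
  "colon R M N = {r \<in> carrier R. \<forall>m\<in>carrier M. r \<odot>\<^bsub>M\<^esub> m \<in> N}"

definition faithful_module :: "('a, 'r) ring_scheme \<Rightarrow> ('a, 'b, 'm) module_scheme \<Rightarrow> bool" where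
  "faithful_module R M \<longleftrightarrow> colon R M {\<zero>\<^bsub>M\<^esub>} = {\<zero>\<^bsub>R\<^esub>}"

definition gen_submodule ::
    "('a, 'r) ring_scheme \<Rightarrow> ('a, 'b, 'm) module_scheme \<Rightarrow> 'b set \<Rightarrow> 'b set" where
  "gen_submodule R M A = \<Inter>{H. submodule H R M \<and> A \<subseteq> H}"

definition fin_gen_module :: "('a, 'r) ring_scheme \<Rightarrow> ('a, 'b, 'm) module_scheme \<Rightarrow> bool" where
  "fin_gen_module R M \<longleftrightarrow>
     (\<exists>A. finite A \<and> A \<subseteq> carrier M \<and> gen_submodule R M A = carrier M)"

definition ideal_smult ::
    "('a, 'r) ring_scheme \<Rightarrow> ('a, 'b, 'm) module_scheme \<Rightarrow> 'a set \<Rightarrow> 'b set" where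
  "ideal_smult R M I = gen_submodule R M {i \<odot>\<^bsub>M\<^esub> m | i m. i \<in> I \<and> m \<in> carrier M}"

definition multiplication_module ::
    "('a, 'r) ring_scheme \<Rightarrow> ('a, 'b, 'm) module_scheme \<Rightarrow> bool" where
  "multiplication_module R M \<longleftrightarrow>
     (\<forall>N. submodule N R M \<longrightarrow> (\<exists>I. ideal I R \<and> N = ideal_smult R M I))"

text \<open>The value does not depend on the presenting ideals; see \<open>submodule_prod_eq\<close> below.\<close>

definition submodule_prod ::
    "('a, 'r) ring_scheme \<Rightarrow> ('a, 'b, 'm) module_scheme \<Rightarrow> 'b set \<Rightarrow> 'b set \<Rightarrow> 'b set" where
  "submodule_prod R M K L =
     (THE P. \<exists>I J. ideal I R \<and> ideal J R \<and> K = ideal_smult R M I \<and> L = ideal_smult R M J \<and>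
                   P = ideal_smult R M (I \<cdot>\<^bsub>R\<^esub> J))"

definition prime_submodule ::
    "('a, 'r) ring_scheme \<Rightarrow> ('a, 'b, 'm) module_scheme \<Rightarrow> 'b set \<Rightarrow> bool" where
  "prime_submodule R M P \<longleftrightarrow>
     submodule P R M \<and> P \<noteq> carrier M \<and>
     (\<forall>r\<in>carrier R. \<forall>m\<in>carrier M. r \<odot>\<^bsub>M\<^esub> m \<in> P \<longrightarrow> r \<in> colon R M P \<or> m \<in> P)"

text \<open>Equal to \<open>carrier M\<close> if no prime submodule contains \<open>N\<close>.\<close>

definition M_rad ::
    "('a, 'r) ring_scheme \<Rightarrow> ('a, 'b, 'm) module_scheme \<Rightarrow> 'b set \<Rightarrow> 'b set" where
  "M_rad R M N = {m \<in> carrier M. \<forall>P. prime_submodule R M P \<and> N \<subseteq> P \<longrightarrow> m \<in> P}"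

definition S_prime_submodule ::
    "('a, 'r) ring_scheme \<Rightarrow> 'a set \<Rightarrow> ('a, 'b, 'm) module_scheme \<Rightarrow> 'b set \<Rightarrow> bool" where
  "S_prime_submodule R S M N \<longleftrightarrow>
     submodule N R M \<and> colon R M N \<inter> S = {} \<and>
     (\<exists>s\<in>S. \<forall>a\<in>carrier R. \<forall>m\<in>carrier M. a \<odot>\<^bsub>M\<^esub> m \<in> N \<longrightarrow>
        s \<otimes>\<^bsub>R\<^esub> a \<in> colon R M N \<or> s \<odot>\<^bsub>M\<^esub> m \<in> N)"

definition S_primary_submodule ::
    "('a, 'r) ring_scheme \<Rightarrow> 'a set \<Rightarrow> ('a, 'b, 'm) module_scheme \<Rightarrow> 'b set \<Rightarrow> bool" where
  "S_primary_submodule R S M N \<longleftrightarrow>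
     submodule N R M \<and> colon R M N \<inter> S = {} \<and>
     (\<exists>s\<in>S. \<forall>a\<in>carrier R. \<forall>m\<in>carrier M. a \<odot>\<^bsub>M\<^esub> m \<in> N \<longrightarrow>
        s \<otimes>\<^bsub>R\<^esub> a \<in> ideal_radical R (colon R M N) \<or> s \<odot>\<^bsub>M\<^esub> m \<in> N)"

definition weakly_S_primary_submodule ::
    "('a, 'r) ring_scheme \<Rightarrow> 'a set \<Rightarrow> ('a, 'b, 'm) module_scheme \<Rightarrow> 'b set \<Rightarrow> bool" where
  "weakly_S_primary_submodule R S M N \<longleftrightarrow>
     submodule N R M \<and> colon R M N \<inter> S = {} \<and>
     (\<exists>s\<in>S. \<forall>a\<in>carrier R. \<forall>m\<in>carrier M. a \<odot>\<^bsub>M\<^esub> m \<noteq> \<zero>\<^bsub>M\<^esub> \<and> a \<odot>\<^bsub>M\<^esub> m \<in> N \<longrightarrow>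
        s \<otimes>\<^bsub>R\<^esub> a \<in> ideal_radical R (colon R M N) \<or> s \<odot>\<^bsub>M\<^esub> m \<in> N)"

definition S_primary_ideal :: "('a, 'r) ring_scheme \<Rightarrow> 'a set \<Rightarrow> 'a set \<Rightarrow> bool" where
  "S_primary_ideal R S I \<longleftrightarrow> S_primary_submodule R S (regular_module R) I"

lemma regular_module_is_module:
  assumes "cring R"
  shows "module R (regular_module R)"
proof -
  interpret cring R by (rule assms)
  have ag: "abelian_group (regular_module R)"
    by (rule abelian_groupI)
       (auto simp: regular_module_def a_ac intro: bexI[where x = "\<ominus>\<^bsub>R\<^esub> x" for x] l_neg)
  show ?thesis
    by (rule moduleI[OF assms ag]) (auto simp: regular_module_def l_distr r_distr m_assoc)
qed

context module
begin

lemma gen_submodule_least: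
  assumes "submodule H R M" "A \<subseteq> H"
  shows "gen_submodule R M A \<subseteq> H"
  using assms by (auto simp: gen_submodule_def)

lemma gen_submodule_superset: "A \<subseteq> gen_submodule R M A"
  by (auto simp: gen_submodule_def)

lemma gen_submodule_is_submodule:
  assumes "A \<subseteq> carrier M"
  shows "submodule (gen_submodule R M A) R M"
proof (rule submoduleI)
  show "gen_submodule R M A \<subseteq> carrier M"
    using gen_submodule_least[OF carrier_is_submodule assms] .
  show "\<zero>\<^bsub>M\<^esub> \<in> gen_submodule R M A"
    using subgroup.one_closed submodule.axioms(1) by (fastforce simp: gen_submodule_def)
qed (auto simp: gen_submodule_def submoduleE)

lemma smult_in_ideal_smult:
  assumes "i \<in> I" "m \<in> carrier M"
  shows "i \<odot>\<^bsub>M\<^esub> m \<in> ideal_smult R M I"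
  using assms gen_submodule_superset[of "{i \<odot>\<^bsub>M\<^esub> m | i m. i \<in> I \<and> m \<in> carrier M}"]
  by (auto simp: ideal_smult_def)

lemma ideal_smult_is_submodule:
  assumes "I \<subseteq> carrier R"
  shows "submodule (ideal_smult R M I) R M"
  unfolding ideal_smult_def using assms by (intro gen_submodule_is_submodule) auto

lemma ideal_smult_least:
  assumes "submodule H R M" "\<And>i m. i \<in> I \<Longrightarrow> m \<in> carrier M \<Longrightarrow> i \<odot>\<^bsub>M\<^esub> m \<in> H"
  shows "ideal_smult R M I \<subseteq> H"
  unfolding ideal_smult_def using assms by (intro gen_submodule_least) auto

lemma ideal_smult_prod:
  assumes I: "ideal I R" and J: "ideal J R"
  shows "ideal_smult R M (I \<cdot>\<^bsub>R\<^esub> J) =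
    gen_submodule R M {i \<odot>\<^bsub>M\<^esub> x | i x. i \<in> I \<and> x \<in> ideal_smult R M J}" (is "?L = ?G")
proof
  have IR: "I \<subseteq> carrier R" and JR: "J \<subseteq> carrier R"
    using I J by (auto dest: ideal.Icarr)
  have PR: "I \<cdot>\<^bsub>R\<^esub> J \<subseteq> carrier R"
    using R.ideal_prod_in_carrier[OF I J] .
  note JM = ideal_smult_is_submodule[OF JR]
  have G: "submodule ?G R M"
    using IR submoduleE(1)[OF JM] by (intro gen_submodule_is_submodule) auto
  note L = ideal_smult_is_submodule[OF PR]
  have "p \<odot>\<^bsub>M\<^esub> m \<in> ?G" if p: "p \<in> I \<cdot>\<^bsub>R\<^esub> J" and m: "m \<in> carrier M" for p m
    using p
  proof induction
    case (prod i j)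
    have "(i \<otimes> j) \<odot>\<^bsub>M\<^esub> m = i \<odot>\<^bsub>M\<^esub> (j \<odot>\<^bsub>M\<^esub> m)"
      using prod IR JR m by (auto intro: smult_assoc1)
    moreover have "j \<odot>\<^bsub>M\<^esub> m \<in> ideal_smult R M J"
      using prod m by (auto intro: smult_in_ideal_smult)
    ultimately show ?case
      using prod gen_submodule_superset[of "{i \<odot>\<^bsub>M\<^esub> x | i x. i \<in> I \<and> x \<in> ideal_smult R M J}"]
      by auto
  next
    case (sum p q)
    have "(p \<oplus> q) \<odot>\<^bsub>M\<^esub> m = p \<odot>\<^bsub>M\<^esub> m \<oplus>\<^bsub>M\<^esub> q \<odot>\<^bsub>M\<^esub> m"
      using sum PR m by (auto intro: smult_l_distr)
    then show ?case
      using sum submoduleE(5)[OF G] by auto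
  qed
  then show "?L \<subseteq> ?G"
    by (rule ideal_smult_least[OF G])
  have "i \<odot>\<^bsub>M\<^esub> x \<in> ?L" if i: "i \<in> I" and x: "x \<in> ideal_smult R M J" for i x
  proof -
    let ?H = "{x \<in> carrier M. i \<odot>\<^bsub>M\<^esub> x \<in> ?L}"
    have iR: "i \<in> carrier R" using i IR by auto
    have "submodule ?H R M"
    proof (rule submoduleI)
      show "\<zero>\<^bsub>M\<^esub> \<in> ?H"
        using iR L subgroup.one_closed[OF submodule.axioms(1)[OF L]] by auto
      show "\<ominus>\<^bsub>M\<^esub> a \<in> ?H" if "a \<in> ?H" for a
        using that iR submoduleE(3)[OF L] by (auto simp: smult_r_minus)
      show "a \<oplus>\<^bsub>M\<^esub> b \<in> ?H" if "a \<in> ?H" "b \<in> ?H" for a b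
        using that iR submoduleE(5)[OF L] by (auto simp: smult_r_distr)
      show "a \<odot>\<^bsub>M\<^esub> y \<in> ?H" if a: "a \<in> carrier R" and y: "y \<in> ?H" for a y
      proof -
        have "i \<odot>\<^bsub>M\<^esub> (a \<odot>\<^bsub>M\<^esub> y) = a \<odot>\<^bsub>M\<^esub> (i \<odot>\<^bsub>M\<^esub> y)"
          using a y iR by (metis (no_types, lifting) R.m_comm mem_Collect_eq smult_assoc1)
        then show ?thesis
          using a y submoduleE(4)[OF L] by auto
      qed
    qed auto
    moreover have "j \<odot>\<^bsub>M\<^esub> m \<in> ?H" if j: "j \<in> J" and m: "m \<in> carrier M" for j m
    proof -
      have "i \<odot>\<^bsub>M\<^esub> (j \<odot>\<^bsub>M\<^esub> m) = (i \<otimes> j) \<odot>\<^bsub>M\<^esub> m"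
        using iR j JR m by (auto intro: smult_assoc1[symmetric])
      moreover have "i \<otimes> j \<in> I \<cdot>\<^bsub>R\<^esub> J"
        using i j by (rule ideal_prod.prod)
      ultimately show ?thesis
        using j JR m by (auto intro: smult_in_ideal_smult)
    qed
    ultimately have "ideal_smult R M J \<subseteq> ?H"
      by (rule ideal_smult_least)
    then show ?thesis using x by auto
  qed
  then show "?G \<subseteq> ?L"
    by (intro gen_submodule_least[OF L]) auto
qed

lemma submodule_prod_eq:
  assumes I: "ideal I R" and J: "ideal J R"
  shows "submodule_prod R M (ideal_smult R M I) (ideal_smult R M J) =
    ideal_smult R M (I \<cdot>\<^bsub>R\<^esub> J)"
  unfolding submodule_prod_def
proof (rule the_equality)
  show "\<exists>I' J'. ideal I' R \<and> ideal J' R \<and> ideal_smult R M I = ideal_smult R M I' \<and>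
      ideal_smult R M J = ideal_smult R M J' \<and>
      ideal_smult R M (I \<cdot>\<^bsub>R\<^esub> J) = ideal_smult R M (I' \<cdot>\<^bsub>R\<^esub> J')"
    using I J by blast
next
  fix P
  assume "\<exists>I' J'. ideal I' R \<and> ideal J' R \<and> ideal_smult R M I = ideal_smult R M I' \<and>
      ideal_smult R M J = ideal_smult R M J' \<and> P = ideal_smult R M (I' \<cdot>\<^bsub>R\<^esub> J')"
  then obtain I' J' where I': "ideal I' R" and J': "ideal J' R"
    and eq: "ideal_smult R M I = ideal_smult R M I'" "ideal_smult R M J = ideal_smult R M J'"
    and P: "P = ideal_smult R M (I' \<cdot>\<^bsub>R\<^esub> J')"
    by blast
  have "P = ideal_smult R M (I' \<cdot>\<^bsub>R\<^esub> J)"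
    using P eq by (simp add: ideal_smult_prod I' J' J)
  also have "\<dots> = ideal_smult R M (J \<cdot>\<^bsub>R\<^esub> I')"
    using R.ideal_prod_commute[OF I' J] by simp
  also have "\<dots> = ideal_smult R M (J \<cdot>\<^bsub>R\<^esub> I)"
    using eq by (simp add: ideal_smult_prod I I' J)
  also have "\<dots> = ideal_smult R M (I \<cdot>\<^bsub>R\<^esub> J)"
    using R.ideal_prod_commute[OF I J] by simp
  finally show "P = ideal_smult R M (I \<cdot>\<^bsub>R\<^esub> J)" .
qed

end

end

theory Submission
  imports Defs
begin

text \<open>
  For finitely generated \<open>M\<close>, the colon ideal of \<open>M_rad N\<close> is the radical of \<open>(N : M)\<close>: given \<open>r\<close>
  with no power in \<open>(N : M)\<close>, a submodule containing \<open>N\<close> that is maximal among those whose colon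
  ideal contains no power of \<open>r\<close> is prime.

  If \<open>{0}\<close> is \<open>S\<close>-primary, a case distinction on \<open>a\<^sup>n b\<^sup>n = 0\<close> shows that this radical is
  \<open>S\<close>-prime as an ideal, and writing \<open>R m = J M\<close> transfers this to \<open>M_rad N\<close>.

  If \<open>N\<close> is not \<open>S\<close>-primary, a pair \<open>(a, m)\<close> with \<open>a m = 0\<close> violates the \<open>S\<close>-primary condition.
  Perturbing it to \<open>(a + r, m + x)\<close> with \<open>r \<in> (N : M)\<close> and \<open>x \<in> N\<close> shows \<open>(N : M) N = 0\<close>.
\<close>

section \<open>Residual submodules, colon ideals and prime submodules from Zorn's lemma\<close>

context module
begin

text \<open>Multiplication by \<open>r\<close> is linear because \<open>R\<close> is commutative,
  and this is the preimage of \<open>H\<close> under it. Used to extend a membership known for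
  generators to the submodule that they generate.\<close>

lemma submodule_residual:
  assumes H: "submodule H R M" and r: "r \<in> carrier R"
  shows "submodule {x \<in> carrier M. r \<odot>\<^bsub>M\<^esub> x \<in> H} R M" (is "submodule ?H R M")
proof (rule submoduleI)
  show "\<zero>\<^bsub>M\<^esub> \<in> ?H"
    using r subgroup.one_closed[OF submodule.axioms(1)[OF H]] by auto
  show "\<ominus>\<^bsub>M\<^esub> a \<in> ?H" if "a \<in> ?H" for a
    using that r submoduleE(3)[OF H] by (auto simp: smult_r_minus)
  show "a \<oplus>\<^bsub>M\<^esub> b \<in> ?H" if "a \<in> ?H" "b \<in> ?H" for a b
    using that r submoduleE(5)[OF H] by (auto simp: smult_r_distr)
  show "a \<odot>\<^bsub>M\<^esub> y \<in> ?H" if a: "a \<in> carrier R" and y: "y \<in> ?H" for a y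
  proof -
    have "r \<odot>\<^bsub>M\<^esub> (a \<odot>\<^bsub>M\<^esub> y) = a \<odot>\<^bsub>M\<^esub> (r \<odot>\<^bsub>M\<^esub> y)"
      using a y r by (metis (no_types, lifting) R.m_comm mem_Collect_eq smult_assoc1)
    then show ?thesis
      using a y submoduleE(4)[OF H] by auto
  qed
qed auto

lemma submodule_zero_closed: "submodule H R M \<Longrightarrow> \<zero>\<^bsub>M\<^esub> \<in> H"
  using subgroup.one_closed[OF submodule.axioms(1)] by force

lemma submodule_add_cancel:
  assumes "submodule H R M" "x \<in> H" "y \<in> carrier M" "x \<oplus>\<^bsub>M\<^esub> y \<in> H"
  shows "y \<in> H"
proof -
  have "x \<in> carrier M" using assms submoduleE(1) by blast
  then have "y = \<ominus>\<^bsub>M\<^esub> x \<oplus>\<^bsub>M\<^esub> (x \<oplus>\<^bsub>M\<^esub> y)"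
    using assms by (simp add: M.r_neg1)
  then show ?thesis
    using assms submoduleE(3,5) by metis
qed

lemma submodule_Union_chain:
  assumes ne: "C \<noteq> {}" and ch: "subset.chain {H. submodule H R M} C"
  shows "submodule (\<Union>C) R M"
proof (rule submoduleI)
  have C: "submodule H R M" if "H \<in> C" for H
    using ch that by (auto simp: subset.chain_def)
  show "\<Union>C \<subseteq> carrier M"
    using C submoduleE(1) by blast
  show "\<zero>\<^bsub>M\<^esub> \<in> \<Union>C"
    using C ne submodule_zero_closed by blast
  show "\<ominus>\<^bsub>M\<^esub> a \<in> \<Union>C" if "a \<in> \<Union>C" for a
    using C that submoduleE(3) by blast
  show "a \<odot>\<^bsub>M\<^esub> x \<in> \<Union>C" if "a \<in> carrier R" "x \<in> \<Union>C" for a x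
    using C that submoduleE(4) by blast
  fix a b assume "a \<in> \<Union>C" "b \<in> \<Union>C"
  then obtain A B where AB: "A \<in> C" "a \<in> A" "B \<in> C" "b \<in> B" by blast
  then have "A \<subseteq> B \<or> B \<subseteq> A"
    using ch by (auto simp: subset_chain_def)
  then show "a \<oplus>\<^bsub>M\<^esub> b \<in> \<Union>C"
    using AB C submoduleE(5) by blast
qed

lemma submodule_colon_ideal:
  assumes H: "submodule H R M"
  shows "ideal (colon R M H) R"
proof (rule idealI)
  show "subgroup (colon R M H) (add_monoid R)"
  proof (rule R.add.subgroupI)
    show "colon R M H \<noteq> {}"
      using submodule_zero_closed[OF H] by (auto simp: colon_def intro!: exI[of _ \<zero>])
    show "\<ominus> a \<in> colon R M H" if "a \<in> colon R M H" for a
      using that submoduleE(3)[OF H] by (auto simp: colon_def smult_l_minus)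
    show "a \<oplus> b \<in> colon R M H" if "a \<in> colon R M H" "b \<in> colon R M H" for a b
      using that submoduleE(5)[OF H] by (auto simp: colon_def smult_l_distr)
  qed (auto simp: colon_def)
  show "x \<otimes> a \<in> colon R M H" if "a \<in> colon R M H" "x \<in> carrier R" for a x
    using that submoduleE(4)[OF H] by (auto simp: colon_def smult_assoc1)
  then show "a \<otimes> x \<in> colon R M H" if "a \<in> colon R M H" "x \<in> carrier R" for a x
    using that by (metis (no_types, lifting) R.m_comm colon_def mem_Collect_eq)
qed (rule R.ring_axioms)

text \<open>Only finitely many generators have to be sent into the union, so one member
  \<open>H\<close> of the chain already receives all their images; the residual of \<open>H\<close>
  by \<open>r\<close> then contains the generators and hence all of \<open>M\<close>.\<close>

lemma fin_gen_colon_Union_chain: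
  assumes fg: "fin_gen_module R M" and ne: "C \<noteq> {}"
    and ch: "subset.chain {H. submodule H R M} C"
    and r: "r \<in> colon R M (\<Union>C)"
  obtains H where "H \<in> C" "r \<in> colon R M H"
proof -
  obtain A where A: "finite A" "A \<subseteq> carrier M" "gen_submodule R M A = carrier M"
    using fg by (auto simp: fin_gen_module_def)
  have rR: "r \<in> carrier R" and "(\<odot>\<^bsub>M\<^esub>) r ` A \<subseteq> \<Union>C"
    using r A by (auto simp: colon_def)
  then obtain H where H: "H \<in> C" "(\<odot>\<^bsub>M\<^esub>) r ` A \<subseteq> H"
    using finite_subset_Union_chain[OF _ _ ne ch] A(1) by blast
  then have "submodule H R M"
    using ch by (auto simp: subset.chain_def)
  then have "carrier M \<subseteq> {x \<in> carrier M. r \<odot>\<^bsub>M\<^esub> x \<in> H}"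
    using gen_submodule_least[OF submodule_residual[OF _ rR], of H A] A H by auto
  then show thesis
    using that H(1) rR by (auto simp: colon_def)
qed

text \<open>Module counterpart of an ideal maximal among those missing the powers of an element. If
  \<open>a m\<close> lay in the maximal \<open>P\<close> with \<open>m\<close> outside
  \<open>P\<close> and \<open>a M\<close> not inside \<open>P\<close>, passing twice to a strictly
  larger residual of \<open>P\<close> would produce a power of \<open>r\<close> in
  \<open>(P : M)\<close>.\<close>

lemma exists_prime_submodule_avoiding_powers:
  assumes fg: "fin_gen_module R M" and N: "submodule N R M" and r: "r \<in> carrier R"
    and avoid: "\<And>k::nat. r [^] k \<notin> colon R M N"
  obtains P where "prime_submodule R M P" "N \<subseteq> P" "r \<notin> colon R M P"
proof -
  define F where "F = {H. submodule H R M \<and> N \<subseteq> H \<and> (\<forall>k::nat. r [^] k \<notin> colon R M H)}"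
  \<comment> \<open>A power of \<open>r\<close> carrying \<open>M\<close> into the union would carry
    it into a single member of the chain, against membership in \<open>F\<close>.\<close>
  have "\<Union>C \<in> F" if ne: "C \<noteq> {}" and "subset.chain F C" for C
  proof -
    have ch: "subset.chain {H. submodule H R M} C" and CF: "C \<subseteq> F"
      using that by (auto simp: subset.chain_def F_def)
    show "\<Union>C \<in> F"
      using submodule_Union_chain[OF ne ch] CF ne fin_gen_colon_Union_chain[OF fg ne ch]
      unfolding F_def by blast
  qed
  moreover have "F \<noteq> {}"
    using N avoid by (auto simp: F_def)
  ultimately obtain P where P: "P \<in> F" "\<And>X. X \<in> F \<Longrightarrow> P \<subseteq> X \<Longrightarrow> X = P"
    using subset_Zorn_nonempty[of F] by metis
  then have sP: "submodule P R M" and NP: "N \<subseteq> P" and avP: "\<And>k::nat. r [^] k \<notin> colon R M P"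
    by (auto simp: F_def)
  \<comment> \<open>An element \<open>y\<close> outside \<open>P\<close> with \<open>c y\<close> in
    \<open>P\<close> makes the residual of \<open>P\<close> by \<open>c\<close> strictly larger than
    \<open>P\<close>, so by maximality its colon ideal contains a power of \<open>r\<close>.\<close>
  have grow: "\<exists>k::nat. \<forall>x\<in>carrier M. r [^] k \<odot>\<^bsub>M\<^esub> (c \<odot>\<^bsub>M\<^esub> x) \<in> P"
    if c: "c \<in> carrier R" and y: "y \<in> carrier M" "y \<notin> P" "c \<odot>\<^bsub>M\<^esub> y \<in> P" for c y
  proof -
    let ?K = "{x \<in> carrier M. c \<odot>\<^bsub>M\<^esub> x \<in> P}"
    have K: "submodule ?K R M" "P \<subseteq> ?K" "?K \<noteq> P"
      using submodule_residual[OF sP c] submoduleE(1,4)[OF sP] c y by auto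
    then obtain k :: nat where k: "r [^] k \<in> colon R M ?K"
      using P(2)[of ?K] NP by (auto simp: F_def)
    have "r [^] k \<odot>\<^bsub>M\<^esub> (c \<odot>\<^bsub>M\<^esub> x) \<in> P" if x: "x \<in> carrier M" for x
    proof -
      have "r [^] k \<odot>\<^bsub>M\<^esub> (c \<odot>\<^bsub>M\<^esub> x) = c \<odot>\<^bsub>M\<^esub> (r [^] k \<odot>\<^bsub>M\<^esub> x)"
        using c x r by (metis R.m_comm R.nat_pow_closed smult_assoc1)
      then show ?thesis using k x by (simp add: colon_def)
    qed
    then show ?thesis by blast
  qed
  have "prime_submodule R M P"
    unfolding prime_submodule_def
  proof (intro conjI ballI impI)
    \<comment> \<open>Exponent 0 is among the avoided powers: the unit does not lie in
      \<open>(P : M)\<close>.\<close>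
    show "P \<noteq> carrier M"
      using avP[of 0] by (auto simp: colon_def)
    fix a m assume a: "a \<in> carrier R" and m: "m \<in> carrier M" and am: "a \<odot>\<^bsub>M\<^esub> m \<in> P"
    show "a \<in> colon R M P \<or> m \<in> P"
    proof (rule ccontr)
      assume "\<not> (a \<in> colon R M P \<or> m \<in> P)"
      then obtain y where y: "y \<in> carrier M" "a \<odot>\<^bsub>M\<^esub> y \<notin> P" and "m \<notin> P"
        using a by (auto simp: colon_def)
      then obtain k :: nat where k: "\<forall>x\<in>carrier M. r [^] k \<odot>\<^bsub>M\<^esub> (a \<odot>\<^bsub>M\<^esub> x) \<in> P"
        using grow[OF a m _ am] by blast
      \<comment> \<open>Now \<open>r [^] k\<close> is the scalar and \<open>a y\<close> the witness:
        \<open>a y\<close> is outside \<open>P\<close> and \<open>r [^] k\<close> moves it into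
        \<open>P\<close>.\<close>
      then obtain l :: nat
        where l: "\<forall>x\<in>carrier M. r [^] l \<odot>\<^bsub>M\<^esub> (r [^] k \<odot>\<^bsub>M\<^esub> x) \<in> P"
        using grow[of "r [^] k" "a \<odot>\<^bsub>M\<^esub> y"] a y r by auto
      have "r [^] (l + k) \<in> colon R M P"
        using l r by (simp add: colon_def R.nat_pow_mult[symmetric] smult_assoc1)
      then show False using avP by blast
    qed
  qed (rule sP)
  moreover have "r \<notin> colon R M P"
    using avP[of 1] r by simp
  ultimately show thesis
    using that NP by blast
qed

section \<open>The M-radical and its colon ideal\<close>

lemma M_rad_is_submodule: "submodule (M_rad R M N) R M"
  by (rule submoduleI)
     (auto simp: M_rad_def prime_submodule_def submoduleE submodule_zero_closed)

text \<open>Primeness strips one factor at a time: with \<open>r\<close> outside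
  \<open>(P : M)\<close>, \<open>r (r^n m) \<in> P\<close> forces \<open>r^n m \<in> P\<close> for
  all \<open>m\<close>.\<close>

lemma prime_submodule_colon_pow:
  assumes P: "prime_submodule R M P" and r: "r \<in> carrier R"
  shows "r [^] (n::nat) \<in> colon R M P \<Longrightarrow> r \<in> colon R M P"
proof (induction n)
  case 0
  \<comment> \<open>The zeroth power is the unit, so every \<open>m\<close> lies in
    \<open>P\<close>.\<close>
  then show ?case
    using P r submoduleE(4) by (auto simp: colon_def prime_submodule_def)
next
  case (Suc n)
  show ?case
  proof (rule ccontr)
    assume nr: "r \<notin> colon R M P"
    have "r [^] n \<odot>\<^bsub>M\<^esub> m \<in> P" if m: "m \<in> carrier M" for m
    proof -
      have "r \<odot>\<^bsub>M\<^esub> (r [^] n \<odot>\<^bsub>M\<^esub> m) \<in> P"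
        using Suc.prems m r
        by (auto simp: colon_def R.m_comm[of "r [^] n" r] smult_assoc1)
      then show ?thesis
        using P r m nr unfolding prime_submodule_def by blast
    qed
    then show False
      using Suc.IH nr r by (auto simp: colon_def)
  qed
qed

text \<open>Reduces questions on the M-radical to the radical of an ideal of \<open>R\<close>.
  Elements outside that radical are separated by a prime submodule over \<open>N\<close>;
  conversely, a power in \<open>(N : M)\<close> lies in \<open>(P : M)\<close> for each such prime
  \<open>P\<close>.\<close>

lemma colon_M_rad:
  assumes fg: "fin_gen_module R M" and N: "submodule N R M"
  shows "colon R M (M_rad R M N) = ideal_radical R (colon R M N)"
proof
  show "colon R M (M_rad R M N) \<subseteq> ideal_radical R (colon R M N)"
  proof
    fix r assume r: "r \<in> colon R M (M_rad R M N)"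
    then have rR: "r \<in> carrier R" by (auto simp: colon_def)
    show "r \<in> ideal_radical R (colon R M N)"
    proof (rule ccontr)
      assume nr: "r \<notin> ideal_radical R (colon R M N)"
      interpret I: ideal "colon R M N" R by (rule submodule_colon_ideal[OF N])
      have "r [^] k \<notin> colon R M N" for k :: nat
      proof
        assume "r [^] k \<in> colon R M N"
        \<comment> \<open>\<open>ideal_radical\<close> asks for a positive exponent while
          \<open>k\<close> may be 0, hence the shift to \<open>Suc k\<close>.\<close>
        then have "r [^] Suc k \<in> colon R M N"
          using rR I.I_r_closed by simp
        then show False
          using nr rR by (auto simp: ideal_radical_def)
      qed
      then obtain P where "prime_submodule R M P" "N \<subseteq> P" "r \<notin> colon R M P"
        using exists_prime_submodule_avoiding_powers[OF fg N rR] by blast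
      then show False
        using r unfolding colon_def M_rad_def by blast
    qed
  qed
  show "ideal_radical R (colon R M N) \<subseteq> colon R M (M_rad R M N)"
  proof
    fix r assume "r \<in> ideal_radical R (colon R M N)"
    then obtain n :: nat where r: "r \<in> carrier R" and n: "r [^] n \<in> colon R M N"
      unfolding ideal_radical_def by blast
    have "r \<in> colon R M P" if "prime_submodule R M P" "N \<subseteq> P" for P
      using prime_submodule_colon_pow[OF that(1) r, of n] n that(2) unfolding colon_def by blast
    then show "r \<in> colon R M (M_rad R M N)"
      using r unfolding colon_def M_rad_def by blast
  qed
qed

end

section \<open>Radicals of ideals and powers in \<open>S\<close>\<close>

lemma (in cring) ideal_pow_add:
  assumes I: "ideal I R" and x: "x \<in> carrier R" and y: "y \<in> I"
  shows "\<exists>c\<in>I. (x \<oplus> y) [^] (n::nat) = x [^] n \<oplus> c"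
proof (induction n)
  interpret I: ideal I R by (rule I)
  case 0
  show ?case by (intro bexI[of _ \<zero>]) auto
next
  interpret I: ideal I R by (rule I)
  case (Suc n)
  then obtain c where c: "c \<in> I" "(x \<oplus> y) [^] n = x [^] n \<oplus> c" by blast
  note carr = x I.Icarr[OF y] I.Icarr[OF c(1)]
  have "(x \<oplus> y) [^] Suc n = (x [^] n \<oplus> c) \<otimes> (x \<oplus> y)"
    using c by simp
  also have "\<dots> = x [^] Suc n \<oplus> (x [^] n \<otimes> y \<oplus> c \<otimes> (x \<oplus> y))"
    using carr by (simp add: l_distr r_distr a_ac)
  finally have "(x \<oplus> y) [^] Suc n = x [^] Suc n \<oplus> (x [^] n \<otimes> y \<oplus> c \<otimes> (x \<oplus> y))" .
  moreover have "x [^] n \<otimes> y \<oplus> c \<otimes> (x \<oplus> y) \<in> I"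
    using carr c y by (simp add: I.a_closed I.I_l_closed I.I_r_closed)
  ultimately show ?case by blast
qed

text \<open>The remainder \<open>c\<close> from \<open>ideal_pow_add\<close> lies in
  \<open>I\<close> and can be subtracted. This lets a scalar outside the radical be perturbed by an
  element of the ideal and stay outside.\<close>

lemma (in cring) ideal_radical_add_cancel:
  assumes I: "ideal I R" and x: "x \<in> carrier R" and y: "y \<in> I"
    and xy: "x \<oplus> y \<in> ideal_radical R I"
  shows "x \<in> ideal_radical R I"
proof -
  interpret I: ideal I R by (rule I)
  obtain n :: nat where n: "n > 0" "(x \<oplus> y) [^] n \<in> I"
    using xy by (auto simp: ideal_radical_def)
  obtain c where c: "c \<in> I" "(x \<oplus> y) [^] n = x [^] n \<oplus> c"
    using ideal_pow_add[OF I x y] by blast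
  have "x [^] n = (x [^] n \<oplus> c) \<oplus> \<ominus> c"
    using x I.Icarr[OF c(1)] by (simp add: a_assoc r_neg)
  also have "\<dots> \<in> I"
    using c n I.a_closed I.a_inv_closed by metis
  finally show ?thesis
    using n x by (auto simp: ideal_radical_def)
qed

text \<open>\<open>(s a)^n = s^(n-1) (s a^n)\<close>, where \<open>n > 0\<close> makes the exponent
  \<open>n - 1\<close> meaningful; raising to the \<open>k\<close>-th power lands in
  \<open>I\<close>. It brings conclusions about \<open>a^n\<close> back to \<open>a\<close>.\<close>

lemma (in cring) ideal_radical_mult_pow:
  assumes I: "ideal I R" and s: "s \<in> carrier R" and a: "a \<in> carrier R" and n: "n > 0"
    and sa: "s \<otimes> a [^] (n::nat) \<in> ideal_radical R I"
  shows "s \<otimes> a \<in> ideal_radical R I"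
proof -
  interpret I: ideal I R by (rule I)
  obtain k :: nat where k: "k > 0" "(s \<otimes> a [^] n) [^] k \<in> I"
    using sa by (auto simp: ideal_radical_def)
  obtain n' where n': "n = Suc n'" using n gr0_conv_Suc by blast
  have "(s \<otimes> a) [^] n = s [^] n' \<otimes> (s \<otimes> a [^] n)"
    using s a by (simp add: n' nat_pow_distrib m_ac)
  then have "(s \<otimes> a) [^] (n * k) = (s [^] n') [^] k \<otimes> (s \<otimes> a [^] n) [^] k"
    using s a by (simp add: nat_pow_pow[symmetric] nat_pow_distrib)
  then have "(s \<otimes> a) [^] (n * k) \<in> I"
    using k(2) s by (simp add: I.I_l_closed)
  then show ?thesis
    using n k s a by (auto simp: ideal_radical_def intro!: exI[of _ "n * k"])
qed

text \<open>\<open>S\<close> need not contain the unit, which restricts this to positive exponents.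
  It turns disjointness of \<open>S\<close> from \<open>(N : M)\<close> into disjointness from the
  radical.\<close>

lemma mult_closed_subset_pow:
  assumes "monoid R" "mult_closed_subset R S" "s \<in> S" "n > 0"
  shows "s [^]\<^bsub>R\<^esub> (n::nat) \<in> S"
  using \<open>n > 0\<close>
proof (induction n rule: nat_induct_non_zero)
  case 1
  interpret monoid R by (rule assms(1))
  have "s \<in> carrier R" using assms by (auto simp: mult_closed_subset_def)
  then show ?case using assms by simp
next
  case (Suc n)
  interpret monoid R by (rule assms(1))
  show ?case using Suc assms by (simp add: mult_closed_subset_def)
qed

section \<open>S-primeness of the M-radical\<close>

context module
begin

text \<open>Suppose \<open>s a\<close> is outside the radical. Applying \<open>weak\<close> to
  \<open>a\<close> and \<open>b m\<close> yields \<open>s b m \<in> N\<close> whenever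
  \<open>a b m\<close> is nonzero. The remaining \<open>m\<close> are shifted by an
  \<open>m0\<close> with \<open>a b m0\<close> nonzero, which faithfulness provides. In effect
  \<open>(N : M)\<close> satisfies the weak condition as an ideal, with the same
  \<open>s\<close>.\<close>

lemma weakly_S_primary_colon_mult:
  assumes faith: "faithful_module R M" and N: "submodule N R M" and s: "s \<in> carrier R"
    and weak: "\<And>a m. \<lbrakk>a \<in> carrier R; m \<in> carrier M; a \<odot>\<^bsub>M\<^esub> m \<noteq> \<zero>\<^bsub>M\<^esub>; a \<odot>\<^bsub>M\<^esub> m \<in> N\<rbrakk> \<Longrightarrow>
      s \<otimes> a \<in> ideal_radical R (colon R M N) \<or> s \<odot>\<^bsub>M\<^esub> m \<in> N"
    and a: "a \<in> carrier R" and b: "b \<in> carrier R"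
    and ab: "a \<otimes> b \<in> colon R M N" "a \<otimes> b \<noteq> \<zero>"
  shows "s \<otimes> a \<in> ideal_radical R (colon R M N) \<or> s \<otimes> b \<in> colon R M N"
proof (rule disj_imp[THEN iffD2], rule impI)
  assume na: "s \<otimes> a \<notin> ideal_radical R (colon R M N)"
  have smult_ab: "(a \<otimes> b) \<odot>\<^bsub>M\<^esub> m = a \<odot>\<^bsub>M\<^esub> (b \<odot>\<^bsub>M\<^esub> m)" if "m \<in> carrier M" for m
    using that a b by (rule smult_assoc1[rotated 2])
  have nonzero: "s \<odot>\<^bsub>M\<^esub> (b \<odot>\<^bsub>M\<^esub> m) \<in> N"
    if "m \<in> carrier M" "(a \<otimes> b) \<odot>\<^bsub>M\<^esub> m \<noteq> \<zero>\<^bsub>M\<^esub>" for m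
    using weak[of a "b \<odot>\<^bsub>M\<^esub> m"] that a b ab(1) na smult_ab by (auto simp: colon_def)
  have "a \<otimes> b \<notin> colon R M {\<zero>\<^bsub>M\<^esub>}"
    using faith ab by (simp add: faithful_module_def)
  then obtain m0 where m0: "m0 \<in> carrier M" "(a \<otimes> b) \<odot>\<^bsub>M\<^esub> m0 \<noteq> \<zero>\<^bsub>M\<^esub>"
    using a b by (auto simp: colon_def)
  have "s \<odot>\<^bsub>M\<^esub> (b \<odot>\<^bsub>M\<^esub> m) \<in> N" if m: "m \<in> carrier M" for m
  proof (cases "(a \<otimes> b) \<odot>\<^bsub>M\<^esub> m = \<zero>\<^bsub>M\<^esub>")
    case True
    \<comment> \<open>\<open>a b (m0 + m) = a b m0\<close> is nonzero, so \<open>nonzero\<close>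
      covers \<open>m0 + m\<close>; subtracting \<open>s b m0\<close> leaves
      \<open>s b m\<close>.\<close>
    then have "(a \<otimes> b) \<odot>\<^bsub>M\<^esub> (m0 \<oplus>\<^bsub>M\<^esub> m) \<noteq> \<zero>\<^bsub>M\<^esub>"
      using m m0 a b by (simp add: smult_r_distr)
    then have "s \<odot>\<^bsub>M\<^esub> (b \<odot>\<^bsub>M\<^esub> m0) \<oplus>\<^bsub>M\<^esub> s \<odot>\<^bsub>M\<^esub> (b \<odot>\<^bsub>M\<^esub> m) \<in> N"
      using nonzero[of "m0 \<oplus>\<^bsub>M\<^esub> m"] m m0 b s by (simp add: smult_r_distr)
    then show ?thesis
      using submodule_add_cancel[OF N nonzero[OF m0]] m b s by simp
  qed (use m nonzero in blast)
  then show "s \<otimes> b \<in> colon R M N"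
    using s b by (simp add: colon_def smult_assoc1)
qed

text \<open>In a multiplication module the cyclic submodule of \<open>m\<close> is some
  \<open>J M\<close>, so \<open>m\<close> can be traded for scalars. With \<open>W\<close> the
  M-radical, \<open>a m \<in> W\<close> gives \<open>a j \<in> (W : M)\<close> for every
  \<open>j\<close> in \<open>J\<close>; if \<open>s a\<close> is not in \<open>(W : M)\<close>, then
  \<open>prime\<close> gives \<open>s j \<in> (W : M)\<close>, and \<open>s m\<close> lies in
  \<open>s J M\<close>.\<close>

lemma S_prime_M_rad:
  assumes fg: "fin_gen_module R M" and mm: "multiplication_module R M"
    and N: "submodule N R M" and disj: "ideal_radical R (colon R M N) \<inter> S = {}"
    and s: "s \<in> S" "s \<in> carrier R"
    and prime: "\<And>a b. \<lbrakk>a \<in> carrier R; b \<in> carrier R; a \<otimes> b \<in> ideal_radical R (colon R M N)\<rbrakk> \<Longrightarrow>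
      s \<otimes> a \<in> ideal_radical R (colon R M N) \<or> s \<otimes> b \<in> ideal_radical R (colon R M N)"
  shows "S_prime_submodule R S M (M_rad R M N)"
  unfolding S_prime_submodule_def
proof (intro conjI bexI[OF _ s(1)] ballI impI)
  let ?W = "M_rad R M N"
  note W = M_rad_is_submodule[of N] and col = colon_M_rad[OF fg N]
  show "submodule ?W R M" by (rule W)
  show "colon R M ?W \<inter> S = {}" using disj col by simp
  fix a m assume a: "a \<in> carrier R" and m: "m \<in> carrier M" and am: "a \<odot>\<^bsub>M\<^esub> m \<in> ?W"
  show "s \<otimes> a \<in> colon R M ?W \<or> s \<odot>\<^bsub>M\<^esub> m \<in> ?W"
  proof (rule disj_imp[THEN iffD2], rule impI)
    assume na: "s \<otimes> a \<notin> colon R M ?W"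
    obtain J where J: "ideal J R" "gen_submodule R M {m} = ideal_smult R M J"
      using mm gen_submodule_is_submodule[of "{m}"] m by (auto simp: multiplication_module_def)
    have sub: "ideal_smult R M J \<subseteq> {x \<in> carrier M. a \<odot>\<^bsub>M\<^esub> x \<in> ?W}"
      using gen_submodule_least[OF submodule_residual[OF W a], of "{m}"] J m am by auto
    have "ideal_smult R M J \<subseteq> {x \<in> carrier M. s \<odot>\<^bsub>M\<^esub> x \<in> ?W}"
    proof (rule ideal_smult_least[OF submodule_residual[OF W s(2)]])
      fix j y assume j: "j \<in> J" and y: "y \<in> carrier M"
      have jR: "j \<in> carrier R" using J(1) j by (rule ideal.Icarr)
      have "a \<otimes> j \<in> colon R M ?W"
        using sub j jR a smult_in_ideal_smult[of j J] by (auto simp: colon_def smult_assoc1)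
      then have "s \<otimes> j \<in> colon R M ?W"
        using prime[OF a jR] na col by simp
      then show "j \<odot>\<^bsub>M\<^esub> y \<in> {x \<in> carrier M. s \<odot>\<^bsub>M\<^esub> x \<in> ?W}"
        using y jR s by (simp add: colon_def smult_assoc1)
    qed
    then show "s \<odot>\<^bsub>M\<^esub> m \<in> ?W"
      using gen_submodule_superset[of "{m}"] J by auto
  qed
qed

lemma weakly_S_primary_M_rad_S_prime:
  assumes S: "mult_closed_subset R S" and fg: "fin_gen_module R M"
    and faith: "faithful_module R M" and mm: "multiplication_module R M"
    and weakN: "weakly_S_primary_submodule R S M N" and zero: "S_primary_ideal R S {\<zero>}"
  shows "S_prime_submodule R S M (M_rad R M N)"
proof -
  let ?Q = "ideal_radical R (colon R M N)"
  have SR: "S \<subseteq> carrier R" using S by (simp add: mult_closed_subset_def)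
  have N: "submodule N R M" and disj: "colon R M N \<inter> S = {}"
    using weakN by (auto simp: weakly_S_primary_submodule_def)
  interpret I: ideal "colon R M N" R by (rule submodule_colon_ideal[OF N])
  \<comment> \<open>The radical is itself a colon ideal, that of \<open>M_rad R M N\<close>, so no
    binomial expansion is required.\<close>
  have "ideal ?Q R"
    using submodule_colon_ideal[OF M_rad_is_submodule[of N]] colon_M_rad[OF fg N] by simp
  then interpret Q: ideal ?Q R .
  have IQ: "colon R M N \<subseteq> ?Q"
  proof
    fix x assume x: "x \<in> colon R M N"
    then have "x \<in> carrier R" "x [^] (1::nat) \<in> colon R M N"
      using I.Icarr by auto
    then show "x \<in> ?Q"
      unfolding ideal_radical_def using zero_less_one by blast
  qed
  obtain s where s: "s \<in> S" and
    weak: "\<And>a m. \<lbrakk>a \<in> carrier R; m \<in> carrier M; a \<odot>\<^bsub>M\<^esub> m \<noteq> \<zero>\<^bsub>M\<^esub>; a \<odot>\<^bsub>M\<^esub> m \<in> N\<rbrakk> \<Longrightarrow>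
      s \<otimes> a \<in> ?Q \<or> s \<odot>\<^bsub>M\<^esub> m \<in> N"
    using weakN by (auto simp: weakly_S_primary_submodule_def)
  have reg: "carrier (regular_module R) = carrier R" "smult (regular_module R) = mult R"
    by (simp_all add: regular_module_def)
  \<comment> \<open>Evaluation at the unit shows that a scalar killing the regular module is
    zero.\<close>
  have colon_zero: "colon R (regular_module R) {\<zero>} \<subseteq> {\<zero>}"
  proof
    fix x assume "x \<in> colon R (regular_module R) {\<zero>}"
    then have "x \<in> carrier R" "x \<otimes> \<one> = \<zero>"
      using R.one_closed unfolding colon_def reg by blast+
    then show "x \<in> {\<zero>}" by simp
  qed
  obtain t where t: "t \<in> S" and
    prim: "\<forall>a\<in>carrier R. \<forall>b\<in>carrier R. a \<otimes> b = \<zero> \<longrightarrow>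
      t \<otimes> a \<in> ideal_radical R (colon R (regular_module R) {\<zero>}) \<or> t \<otimes> b = \<zero>"
    using zero unfolding S_primary_ideal_def S_primary_submodule_def reg singleton_iff
    by (elim conjE bexE) (rule that)
  have sR: "s \<in> carrier R" and tR: "t \<in> carrier R" using s t SR by auto
  have radical_zero: "ideal_radical R (colon R (regular_module R) {\<zero>}) \<subseteq> ?Q"
  proof
    fix x assume "x \<in> ideal_radical R (colon R (regular_module R) {\<zero>})"
    then obtain n :: nat where "x \<in> carrier R" "n > 0" "x [^] n = \<zero>"
      using colon_zero unfolding ideal_radical_def by blast
    then show "x \<in> ?Q"
      using I.zero_closed unfolding ideal_radical_def by (auto intro!: exI[of _ n])
  qed
  \<comment> \<open>\<open>s\<close> handles the case of nonzero \<open>a^n b^n\<close>,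
    \<open>t\<close> the case where it vanishes; \<open>s \<otimes> t\<close> handles both since
    \<open>?Q\<close> is an ideal.\<close>
  show ?thesis
  proof (rule S_prime_M_rad[OF fg mm N, of S "s \<otimes> t"])
    show "?Q \<inter> S = {}"
      using disj mult_closed_subset_pow[OF R.monoid_axioms S] unfolding ideal_radical_def by blast
    show "s \<otimes> t \<in> S" using S s t by (simp add: mult_closed_subset_def)
    show "s \<otimes> t \<in> carrier R" using sR tR by simp
    fix a b assume a: "a \<in> carrier R" and b: "b \<in> carrier R" and "a \<otimes> b \<in> ?Q"
    then obtain n :: nat where n: "n > 0" "a [^] n \<otimes> b [^] n \<in> colon R M N"
      unfolding ideal_radical_def using R.nat_pow_distrib[OF a b] by fastforce
    have "s \<otimes> a \<in> ?Q \<or> s \<otimes> b \<in> ?Q \<or> t \<otimes> a \<in> ?Q \<or> t \<otimes> b \<in> ?Q"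
    proof (cases "a [^] n \<otimes> b [^] n = \<zero>")
      case True
      then have "t \<otimes> a [^] n \<in> ideal_radical R (colon R (regular_module R) {\<zero>}) \<or>
          t \<otimes> b [^] n = \<zero>"
        using prim R.nat_pow_closed[OF a] R.nat_pow_closed[OF b] by blast
      then have "t \<otimes> a [^] n \<in> ?Q \<or> t \<otimes> b [^] n \<in> ?Q"
        using radical_zero Q.zero_closed by (metis subsetD)
      then show ?thesis
        using R.ideal_radical_mult_pow[OF I.is_ideal tR a n(1)]
          R.ideal_radical_mult_pow[OF I.is_ideal tR b n(1)] by blast
    next
      case False
      have "s \<otimes> a [^] n \<in> ?Q \<or> s \<otimes> b [^] n \<in> colon R M N"
        by (rule weakly_S_primary_colon_mult[OF faith N sR weak
              R.nat_pow_closed[OF a] R.nat_pow_closed[OF b] n(2) False])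
      then have "s \<otimes> a [^] n \<in> ?Q \<or> s \<otimes> b [^] n \<in> ?Q"
        using IQ by blast
      then show ?thesis
        using R.ideal_radical_mult_pow[OF I.is_ideal sR a n(1)]
          R.ideal_radical_mult_pow[OF I.is_ideal sR b n(1)] by blast
    qed
    moreover have "(s \<otimes> t) \<otimes> x = t \<otimes> (s \<otimes> x)" "(s \<otimes> t) \<otimes> x = s \<otimes> (t \<otimes> x)"
      if "x \<in> carrier R" for x
      using that sR tR by (auto simp: R.m_ac)
    ultimately show "(s \<otimes> t) \<otimes> a \<in> ?Q \<or> (s \<otimes> t) \<otimes> b \<in> ?Q"
      using Q.I_l_closed a b sR tR by metis
  qed
qed

section \<open>Weakly S-primary submodules that are not S-primary\<close>

lemma weakly_S_primary_colon_annihilates: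
  assumes SR: "S \<subseteq> carrier R" and weakN: "weakly_S_primary_submodule R S M N"
    and not: "\<not> S_primary_submodule R S M N"
    and r: "r \<in> colon R M N" and x: "x \<in> N"
  shows "r \<odot>\<^bsub>M\<^esub> x = \<zero>\<^bsub>M\<^esub>"
proof -
  let ?Q = "ideal_radical R (colon R M N)"
  have N: "submodule N R M" and disj: "colon R M N \<inter> S = {}"
    using weakN by (auto simp: weakly_S_primary_submodule_def)
  interpret I: ideal "colon R M N" R by (rule submodule_colon_ideal[OF N])
  obtain s where s: "s \<in> S" and
    weak: "\<And>a m. \<lbrakk>a \<in> carrier R; m \<in> carrier M; a \<odot>\<^bsub>M\<^esub> m \<in> N\<rbrakk> \<Longrightarrow>
      s \<otimes> a \<in> ?Q \<or> s \<odot>\<^bsub>M\<^esub> m \<in> N \<or> a \<odot>\<^bsub>M\<^esub> m = \<zero>\<^bsub>M\<^esub>"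
    using weakN unfolding weakly_S_primary_submodule_def by blast
  have sR: "s \<in> carrier R" using s SR by auto
  \<comment> \<open>Every element of \<open>S\<close> fails the S-primary condition; the failure is
    taken for the same \<open>s\<close>, so that \<open>weak\<close> leaves only
    \<open>a m = 0\<close>.\<close>
  obtain a m where a: "a \<in> carrier R" and m: "m \<in> carrier M" and amN: "a \<odot>\<^bsub>M\<^esub> m \<in> N"
    and na: "s \<otimes> a \<notin> ?Q" and nm: "s \<odot>\<^bsub>M\<^esub> m \<notin> N"
    using not N disj s unfolding S_primary_submodule_def by blast
  have am: "a \<odot>\<^bsub>M\<^esub> m = \<zero>\<^bsub>M\<^esub>" using weak[OF a m amN] na nm by blast
  \<comment> \<open>All three properties of the pair \<open>(a, m)\<close> used so far survive the
    perturbation, so \<open>weak\<close> annihilates the new product as well.\<close>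
  have perturb: "(a \<oplus> q) \<odot>\<^bsub>M\<^esub> (m \<oplus>\<^bsub>M\<^esub> y) = \<zero>\<^bsub>M\<^esub>" if q: "q \<in> colon R M N" and y: "y \<in> N" for q y
  proof -
    have qR: "q \<in> carrier R" and yM: "y \<in> carrier M"
      using q y I.Icarr submoduleE(1)[OF N] by auto
    have "(a \<oplus> q) \<odot>\<^bsub>M\<^esub> (m \<oplus>\<^bsub>M\<^esub> y) \<in> N"
    proof -
      have "(a \<oplus> q) \<odot>\<^bsub>M\<^esub> (m \<oplus>\<^bsub>M\<^esub> y) = a \<odot>\<^bsub>M\<^esub> m \<oplus>\<^bsub>M\<^esub> a \<odot>\<^bsub>M\<^esub> y \<oplus>\<^bsub>M\<^esub> q \<odot>\<^bsub>M\<^esub> (m \<oplus>\<^bsub>M\<^esub> y)"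
        using a m qR yM by (simp add: smult_l_distr smult_r_distr M.a_ac)
      moreover have "q \<odot>\<^bsub>M\<^esub> (m \<oplus>\<^bsub>M\<^esub> y) \<in> N"
        using q m yM unfolding colon_def by blast
      ultimately show ?thesis
        using submoduleE(5)[OF N submoduleE(5)[OF N amN submoduleE(4)[OF N a y]]] by metis
    qed
    moreover have "s \<odot>\<^bsub>M\<^esub> (m \<oplus>\<^bsub>M\<^esub> y) \<notin> N"
    proof
      assume "s \<odot>\<^bsub>M\<^esub> (m \<oplus>\<^bsub>M\<^esub> y) \<in> N"
      then have "s \<odot>\<^bsub>M\<^esub> y \<oplus>\<^bsub>M\<^esub> s \<odot>\<^bsub>M\<^esub> m \<in> N"
        using sR m yM by (simp add: smult_r_distr M.a_comm)
      then show False
        using submodule_add_cancel[OF N submoduleE(4)[OF N sR y]] nm sR m by simp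
    qed
    moreover have "s \<otimes> (a \<oplus> q) \<notin> ?Q"
    proof
      assume "s \<otimes> (a \<oplus> q) \<in> ?Q"
      then have "s \<otimes> a \<oplus> s \<otimes> q \<in> ?Q"
        using sR a qR by (simp add: R.r_distr)
      then show False
        using R.ideal_radical_add_cancel[OF I.is_ideal _ I.I_l_closed[OF q sR]] na sR a by simp
    qed
    ultimately show ?thesis
      using weak[of "a \<oplus> q" "m \<oplus>\<^bsub>M\<^esub> y"] a m qR yM by blast
  qed
  have rR: "r \<in> carrier R" and xM: "x \<in> carrier M"
    using r x I.Icarr submoduleE(1)[OF N] by auto
  \<comment> \<open>The perturbations \<open>(0, x)\<close> and \<open>(r, 0)\<close> give
    \<open>a x = 0\<close> and \<open>r m = 0\<close>; expanding the one by \<open>(r, x)\<close>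
    then leaves only \<open>r x\<close>.\<close>
  have ax: "a \<odot>\<^bsub>M\<^esub> x = \<zero>\<^bsub>M\<^esub>"
    using perturb[OF I.zero_closed x] a m xM am by (simp add: smult_r_distr)
  have rm: "r \<odot>\<^bsub>M\<^esub> m = \<zero>\<^bsub>M\<^esub>"
    using perturb[OF r submodule_zero_closed[OF N]] a m rR am by (simp add: smult_l_distr)
  show ?thesis
    using perturb[OF r x] a m rR xM am ax rm by (simp add: smult_l_distr smult_r_distr)
qed

section \<open>Consequences of \<open>(N : M) N = 0\<close>\<close>

lemma submodule_zero: "submodule {\<zero>\<^bsub>M\<^esub>} R M"
  by (rule submoduleI) auto

text \<open>With \<open>N = I M\<close>, the square \<open>I I M\<close> is generated by the
  products of \<open>I\<close> with \<open>N\<close>, and \<open>I\<close> lies in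
  \<open>(N : M)\<close>.\<close>

lemma submodule_prod_self_eq_zero:
  assumes mm: "multiplication_module R M" and N: "submodule N R M"
    and ann: "\<And>r x. \<lbrakk>r \<in> colon R M N; x \<in> N\<rbrakk> \<Longrightarrow> r \<odot>\<^bsub>M\<^esub> x = \<zero>\<^bsub>M\<^esub>"
  shows "submodule_prod R M N N = {\<zero>\<^bsub>M\<^esub>}"
proof -
  obtain I where I: "ideal I R" and NI: "N = ideal_smult R M I"
    using mm N by (auto simp: multiplication_module_def)
  have IN: "I \<subseteq> colon R M N"
    using ideal.Icarr[OF I] smult_in_ideal_smult[of _ I] NI by (auto simp: colon_def)
  have "submodule_prod R M N N = gen_submodule R M {i \<odot>\<^bsub>M\<^esub> x | i x. i \<in> I \<and> x \<in> N}"
    using submodule_prod_eq[OF I I] ideal_smult_prod[OF I I] NI by simp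
  also have "\<dots> = {\<zero>\<^bsub>M\<^esub>}"
  proof
    show "gen_submodule R M {i \<odot>\<^bsub>M\<^esub> x | i x. i \<in> I \<and> x \<in> N} \<subseteq> {\<zero>\<^bsub>M\<^esub>}"
      using IN ann by (intro gen_submodule_least[OF submodule_zero]) auto
    show "{\<zero>\<^bsub>M\<^esub>} \<subseteq> gen_submodule R M {i \<odot>\<^bsub>M\<^esub> x | i x. i \<in> I \<and> x \<in> N}"
      by (auto simp: gen_submodule_def submodule_zero_closed)
  qed
  finally show ?thesis .
qed

text \<open>Every prime submodule \<open>P\<close> contains \<open>N = I M\<close>: from
  \<open>i (i m) = 0 \<in> P\<close> primeness gives \<open>i \<in> (P : M)\<close> or
  \<open>i m \<in> P\<close>, and both put \<open>i m\<close> into \<open>P\<close>. Hence the same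
  primes are intersected on both sides.\<close>

lemma M_rad_eq_M_rad_zero:
  assumes mm: "multiplication_module R M" and N: "submodule N R M"
    and ann: "\<And>r x. \<lbrakk>r \<in> colon R M N; x \<in> N\<rbrakk> \<Longrightarrow> r \<odot>\<^bsub>M\<^esub> x = \<zero>\<^bsub>M\<^esub>"
  shows "M_rad R M N = M_rad R M {\<zero>\<^bsub>M\<^esub>}"
proof -
  obtain I where I: "ideal I R" and NI: "N = ideal_smult R M I"
    using mm N by (auto simp: multiplication_module_def)
  have IN: "I \<subseteq> colon R M N"
    using ideal.Icarr[OF I] smult_in_ideal_smult[of _ I] NI by (auto simp: colon_def)
  have "N \<subseteq> P" if P: "prime_submodule R M P" for P
    unfolding NI
  proof (rule ideal_smult_least)
    show sP: "submodule P R M" using P by (simp add: prime_submodule_def)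
    fix i m assume i: "i \<in> I" and m: "m \<in> carrier M"
    have iR: "i \<in> carrier R" using I i by (rule ideal.Icarr)
    have "i \<odot>\<^bsub>M\<^esub> (i \<odot>\<^bsub>M\<^esub> m) = \<zero>\<^bsub>M\<^esub>"
      using ann IN i m by (auto simp: colon_def)
    then have "i \<in> colon R M P \<or> i \<odot>\<^bsub>M\<^esub> m \<in> P"
      using P iR m submodule_zero_closed[OF sP] by (simp add: prime_submodule_def)
    then show "i \<odot>\<^bsub>M\<^esub> m \<in> P"
      using m by (auto simp: colon_def)
  qed
  moreover have "{\<zero>\<^bsub>M\<^esub>} \<subseteq> P" if "prime_submodule R M P" for P
    using that by (auto simp: prime_submodule_def submodule_zero_closed)
  ultimately show ?thesis
    unfolding M_rad_def by blast
qed

text \<open>For \<open>N = I M\<close> and \<open>i\<close> in \<open>I\<close>,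
  \<open>i^2 M\<close> lies in \<open>i N = 0\<close>; faithfulness gives \<open>i^2 = 0\<close> and
  reducedness \<open>i = 0\<close>.\<close>

lemma reduced_colon_annihilates_imp_zero:
  assumes red: "reduced_ring R" and faith: "faithful_module R M"
    and mm: "multiplication_module R M" and N: "submodule N R M"
    and ann: "\<And>r x. \<lbrakk>r \<in> colon R M N; x \<in> N\<rbrakk> \<Longrightarrow> r \<odot>\<^bsub>M\<^esub> x = \<zero>\<^bsub>M\<^esub>"
  shows "N = {\<zero>\<^bsub>M\<^esub>}"
proof -
  obtain I where I: "ideal I R" and NI: "N = ideal_smult R M I"
    using mm N by (auto simp: multiplication_module_def)
  have "I \<subseteq> {\<zero>}"
  proof
    fix i assume i: "i \<in> I"
    have iR: "i \<in> carrier R" using I i by (rule ideal.Icarr)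
    have iN: "i \<in> colon R M N"
      using iR i smult_in_ideal_smult[of i I] NI by (auto simp: colon_def)
    have "(i \<otimes> i) \<odot>\<^bsub>M\<^esub> m = \<zero>\<^bsub>M\<^esub>" if "m \<in> carrier M" for m
      using ann[OF iN, of "i \<odot>\<^bsub>M\<^esub> m"] iN iR that by (simp add: colon_def smult_assoc1)
    then have "i \<otimes> i \<in> colon R M {\<zero>\<^bsub>M\<^esub>}"
      using iR by (simp add: colon_def)
    then have "i [^] (2::nat) = \<zero>"
      using faith iR by (simp add: faithful_module_def numeral_2_eq_2)
    then show "i \<in> {\<zero>}"
      using red iR unfolding reduced_ring_def by blast
  qed
  then have "N \<subseteq> {\<zero>\<^bsub>M\<^esub>}"
    unfolding NI by (intro ideal_smult_least[OF submodule_zero]) auto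
  then show ?thesis
    using submodule_zero_closed[OF N] by blast
qed

end

theorem proposition2:
  fixes R :: "('a, 'r) ring_scheme" and M :: "('a, 'b, 'm) module_scheme" and S :: "'a set"
  assumes "module R M"
    and "mult_closed_subset R S"
    and "fin_gen_module R M"
    and "faithful_module R M"
    and "multiplication_module R M"
  shows "(\<forall>N. weakly_S_primary_submodule R S M N \<longrightarrow>
            (S_primary_ideal R S {\<zero>\<^bsub>R\<^esub>} \<longrightarrow> S_prime_submodule R S M (M_rad R M N)) \<and>
            (\<not> S_primary_submodule R S M N \<longrightarrow>
               submodule_prod R M N N = {\<zero>\<^bsub>M\<^esub>} \<and> M_rad R M N = M_rad R M {\<zero>\<^bsub>M\<^esub>})) \<and>
         (reduced_ring R \<longrightarrow>
            {N. weakly_S_primary_submodule R S M N \<and> N \<noteq> {\<zero>\<^bsub>M\<^esub>}} =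
            {N. S_primary_submodule R S M N \<and> N \<noteq> {\<zero>\<^bsub>M\<^esub>}})"
proof -
  interpret module R M by (rule assms(1))
  have SR: "S \<subseteq> carrier R" using assms(2) by (simp add: mult_closed_subset_def)
  have sub: "submodule N R M" if "weakly_S_primary_submodule R S M N" for N
    using that by (simp add: weakly_S_primary_submodule_def)
  note ann = weakly_S_primary_colon_annihilates[OF SR]
  have "S_prime_submodule R S M (M_rad R M N)"
    if "weakly_S_primary_submodule R S M N" "S_primary_ideal R S {\<zero>\<^bsub>R\<^esub>}" for N
    using weakly_S_primary_M_rad_S_prime[OF assms(2-5)] that .
  moreover have "submodule_prod R M N N = {\<zero>\<^bsub>M\<^esub>} \<and> M_rad R M N = M_rad R M {\<zero>\<^bsub>M\<^esub>}"
    if "weakly_S_primary_submodule R S M N" "\<not> S_primary_submodule R S M N" for N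
    using submodule_prod_self_eq_zero[OF assms(5) sub[OF that(1)] ann[OF that]]
      M_rad_eq_M_rad_zero[OF assms(5) sub[OF that(1)] ann[OF that]] by blast
  \<comment> \<open>By contraposition: failing to be S-primary makes \<open>(N : M)\<close>
    annihilate \<open>N\<close>, which over a reduced ring forces \<open>N\<close> to be
    zero.\<close>
  moreover have "S_primary_submodule R S M N"
    if "reduced_ring R" "weakly_S_primary_submodule R S M N" "N \<noteq> {\<zero>\<^bsub>M\<^esub>}" for N
    using reduced_colon_annihilates_imp_zero[OF that(1) assms(4,5) sub[OF that(2)]]
      ann[OF that(2)] that(3) by blast
  moreover have "weakly_S_primary_submodule R S M N" if "S_primary_submodule R S M N" for N
    using that unfolding S_primary_submodule_def weakly_S_primary_submodule_def by blast
  ultimately show ?thesis by blast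
qed

end
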